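(* Let $S$ be a left Noetherian (not necessarily commutative) ring containing a regular commutative ring $R$ as a subring, such that $S$ considered as a right $R$-module is projective. Assume that for every ideal $I$ of $R$ and every $s \in S$ there exists $r \geq 1$ (depending on $s$) such that $I^r s \subseteq SI$. Let $M$ be a left $S$-module such that $E_S(M)$ is an indecomposable injective $S$-module. Then $\operatorname{Ass}_R E_S(M)$ has a unique maximal element $P$ (with respect to inclusion). Furthermore $P \in \operatorname{Ass}_R M$.
   Context: Rings are associative with identity, and a subring shares the identity. A regular commutative ring is a commutative Noetherian ring all of whose localizations at prime ideals are regular local rings. $SI$ denotes the left ideal of $S$ generated by $I$. $E_S(M)$ denotes the injective hull of $M$ as a left $S$-module. Left $S$-modules are regarded as $R$-modules by restriction of scalars, and $\operatorname{Ass}_R N$ denotes the set of associated primes of the $R$-module $N$, i.e. prime ideals of $R$ of the form $(0 :_R x)$ with $x \in N$. *)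

theory Defs
  imports "HOL-Algebra.Algebra" "HOL-Library.Extended_Nat"
begin

section \<open>Modules over a not necessarily commutative ring\<close>

text \<open>The library locale \<^locale>\<open>module\<close> has the same axioms but a commutative base ring. The
  library's \<^locale>\<open>submodule\<close> does not assume commutativity and is used for submodules of left
  modules as well.\<close>

locale left_module = R?: ring R + M?: abelian_group M
  for R :: "('a, 'r) ring_scheme" (structure) and M :: "('a, 'm, 'c) module_scheme" (structure) +
  assumes smult_closed [simp, intro]:
      "\<lbrakk>a \<in> carrier R; x \<in> carrier M\<rbrakk> \<Longrightarrow> a \<odot>\<^bsub>M\<^esub> x \<in> carrier M"
    and smult_l_distr:
      "\<lbrakk>a \<in> carrier R; b \<in> carrier R; x \<in> carrier M\<rbrakk>
        \<Longrightarrow> (a \<oplus> b) \<odot>\<^bsub>M\<^esub> x = a \<odot>\<^bsub>M\<^esub> x \<oplus>\<^bsub>M\<^esub> b \<odot>\<^bsub>M\<^esub> x"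
    and smult_r_distr:
      "\<lbrakk>a \<in> carrier R; x \<in> carrier M; y \<in> carrier M\<rbrakk>
        \<Longrightarrow> a \<odot>\<^bsub>M\<^esub> (x \<oplus>\<^bsub>M\<^esub> y) = a \<odot>\<^bsub>M\<^esub> x \<oplus>\<^bsub>M\<^esub> a \<odot>\<^bsub>M\<^esub> y"
    and smult_assoc1:
      "\<lbrakk>a \<in> carrier R; b \<in> carrier R; x \<in> carrier M\<rbrakk>
        \<Longrightarrow> (a \<otimes> b) \<odot>\<^bsub>M\<^esub> x = a \<odot>\<^bsub>M\<^esub> (b \<odot>\<^bsub>M\<^esub> x)"
    and smult_one [simp]: "x \<in> carrier M \<Longrightarrow> \<one> \<odot>\<^bsub>M\<^esub> x = x"

lemma module_iff_left_module:
  fixes M :: "('a, 'm, 'c) module_scheme"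
  shows "module R M \<longleftrightarrow> cring R \<and> left_module R M"
  by (auto simp: module_def left_module_def module_axioms_def left_module_axioms_def cring_def)

definition module_hom ::
    "('a, 'r) ring_scheme \<Rightarrow> ('a, 'm, 'c) module_scheme \<Rightarrow> ('a, 'n, 'd) module_scheme \<Rightarrow> ('m \<Rightarrow> 'n) set"
  where "module_hom R M N =
    {f \<in> carrier M \<rightarrow> carrier N.
      (\<forall>x\<in>carrier M. \<forall>y\<in>carrier M. f (x \<oplus>\<^bsub>M\<^esub> y) = f x \<oplus>\<^bsub>N\<^esub> f y) \<and>
      (\<forall>a\<in>carrier R. \<forall>x\<in>carrier M. f (a \<odot>\<^bsub>M\<^esub> x) = a \<odot>\<^bsub>N\<^esub> f x)}"

text \<open>The lifting property below is tested on modules with carrier in \<open>'m + ('m \<Rightarrow> 'a)\<close>, since HOL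
  cannot quantify over types inside a definition. This type contains copies of \<open>M\<close> and of the free
  module on the set underlying \<open>M\<close>, so lifting the identity of \<open>M\<close> along the canonical surjection
  exhibits \<open>M\<close> as a direct summand of a free module, and the lifting property follows for modules
  in every type.\<close>

definition projective_module :: "('a, 'r) ring_scheme \<Rightarrow> ('a, 'm, 'c) module_scheme \<Rightarrow> bool"
  where "projective_module R M \<longleftrightarrow>
    left_module R M \<and>
    (\<forall>(A :: ('a, 'm + ('m \<Rightarrow> 'a)) module) (B :: ('a, 'm + ('m \<Rightarrow> 'a)) module) g f.
      left_module R A \<and> left_module R B \<and>
      g \<in> module_hom R A B \<and> g ` carrier A = carrier B \<and> f \<in> module_hom R M B \<longrightarrow>
      (\<exists>h\<in>module_hom R M A. \<forall>x\<in>carrier M. g (h x) = f x))"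

text \<open>Here the test modules have their carrier in \<open>'a + 'm\<close>. This type contains copies of all left
  ideals of \<open>R\<close> and of \<open>R\<close> itself, so by Baer's criterion the extension property follows for modules
  in every type.\<close>

definition injective_module :: "('a, 'r) ring_scheme \<Rightarrow> ('a, 'm, 'c) module_scheme \<Rightarrow> bool"
  where "injective_module R M \<longleftrightarrow>
    left_module R M \<and>
    (\<forall>(A :: ('a, 'a + 'm) module) (B :: ('a, 'a + 'm) module) f g.
      left_module R A \<and> left_module R B \<and>
      f \<in> module_hom R A B \<and> inj_on f (carrier A) \<and> g \<in> module_hom R A M \<longrightarrow>
      (\<exists>h\<in>module_hom R B M. \<forall>x\<in>carrier A. h (f x) = g x))"

text \<open>Injective hulls are unique only up to isomorphism, so the hull is a relation: \<open>\<iota>\<close> embeds \<open>M\<close> as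
  an essential submodule of the injective module \<open>E\<close>.\<close>

definition injective_hull ::
    "('a, 'r) ring_scheme \<Rightarrow> ('a, 'm, 'c) module_scheme \<Rightarrow> ('a, 'e, 'd) module_scheme \<Rightarrow> ('m \<Rightarrow> 'e) \<Rightarrow> bool"
  where "injective_hull R M E \<iota> \<longleftrightarrow>
    left_module R M \<and> injective_module R E \<and>
    \<iota> \<in> module_hom R M E \<and> inj_on \<iota> (carrier M) \<and>
    (\<forall>N. submodule N R E \<and> N \<noteq> {\<zero>\<^bsub>E\<^esub>} \<longrightarrow> N \<inter> \<iota> ` carrier M \<noteq> {\<zero>\<^bsub>E\<^esub>})"

definition indecomposable_module :: "('a, 'r) ring_scheme \<Rightarrow> ('a, 'm, 'c) module_scheme \<Rightarrow> bool"
  where "indecomposable_module R M \<longleftrightarrow>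
    left_module R M \<and> carrier M \<noteq> {\<zero>\<^bsub>M\<^esub>} \<and>
    (\<forall>A B. submodule A R M \<and> submodule B R M \<and>
      A \<inter> B = {\<zero>\<^bsub>M\<^esub>} \<and> A <+>\<^bsub>M\<^esub> B = carrier M \<longrightarrow> A = {\<zero>\<^bsub>M\<^esub>} \<or> B = {\<zero>\<^bsub>M\<^esub>})"

definition Ass :: "('a, 'r) ring_scheme \<Rightarrow> ('a, 'm, 'c) module_scheme \<Rightarrow> 'a set set"
  where "Ass R N = {P. primeideal P R \<and>
    (\<exists>x\<in>carrier N. P = {a \<in> carrier R. a \<odot>\<^bsub>N\<^esub> x = \<zero>\<^bsub>N\<^esub>})}"

text \<open>\<open>S\<close> as a right module over a commutative subring. For a commutative base ring, right modules are
  modules in the sense of \<^locale>\<open>module\<close>; the scalar \<open>r\<close> acts by right multiplication.\<close>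

definition right_regular_module :: "('a, 'r) ring_scheme \<Rightarrow> ('a, 'a) module"
  where "right_regular_module S =
    \<lparr>carrier = carrier S, monoid.mult = monoid.mult S, one = one S, ring.zero = ring.zero S, add = add S,
     smult = (\<lambda>r s. s \<otimes>\<^bsub>S\<^esub> r)\<rparr>"

lemma right_regular_module_is_module:
  assumes "ring S" "subcring R S"
  shows "module (S\<lparr>carrier := R\<rparr>) (right_regular_module S)"
proof -
  interpret S: ring S by fact
  interpret R: subcring R S by fact
  note RS = subringE[OF R.subring_axioms]
  have sub: "\<And>x. x \<in> R \<Longrightarrow> x \<in> carrier S"
    using RS(1) by blast
  show ?thesis
  proof (rule moduleI)
    show "cring (S\<lparr>carrier := R\<rparr>)"
      using S.subcring_iff[OF RS(1)] assms(2) by blast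
    have "abelian_monoid (right_regular_module S)"
      by (rule abelian_monoidI)
        (auto simp: right_regular_module_def S.a_assoc intro: S.a_comm)
    then show "abelian_group (right_regular_module S)"
      by (intro abelian_groupI)
        (auto simp: right_regular_module_def S.a_assoc intro: S.a_comm S.l_neg S.a_inv_closed)
  next
    fix a b x
    assume "a \<in> carrier (S\<lparr>carrier := R\<rparr>)" "b \<in> carrier (S\<lparr>carrier := R\<rparr>)"
      "x \<in> carrier (right_regular_module S)"
    then show "(a \<otimes>\<^bsub>S\<lparr>carrier := R\<rparr>\<^esub> b) \<odot>\<^bsub>right_regular_module S\<^esub> x =
        a \<odot>\<^bsub>right_regular_module S\<^esub> (b \<odot>\<^bsub>right_regular_module S\<^esub> x)"
      using R.sub_m_comm[of a b] by (simp add: right_regular_module_def S.m_assoc sub)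
  qed (auto simp: right_regular_module_def sub S.r_distr S.l_distr)
qed


section \<open>Left ideals and left Noetherian rings\<close>

definition left_ideal :: "'a set \<Rightarrow> ('a, 'r) ring_scheme \<Rightarrow> bool"
  where "left_ideal J S \<longleftrightarrow>
    additive_subgroup J S \<and> (\<forall>s\<in>carrier S. \<forall>x\<in>J. s \<otimes>\<^bsub>S\<^esub> x \<in> J)"

definition left_ideal_gen :: "('a, 'r) ring_scheme \<Rightarrow> 'a set \<Rightarrow> 'a set"
  where "left_ideal_gen S A = \<Inter>{J. left_ideal J S \<and> A \<subseteq> J}"

definition left_noetherian_ring :: "('a, 'r) ring_scheme \<Rightarrow> bool"
  where "left_noetherian_ring S \<longleftrightarrow>
    ring S \<and>
    (\<forall>J. left_ideal J S \<longrightarrow> (\<exists>A\<subseteq>carrier S. finite A \<and> J = left_ideal_gen S A))"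


section \<open>Regular commutative rings\<close>

definition krull_dim :: "('a, 'r) ring_scheme \<Rightarrow> enat"
  where "krull_dim R =
    (SUP n\<in>{n. \<exists>Q :: nat \<Rightarrow> 'a set. (\<forall>i\<le>n. primeideal (Q i) R) \<and> (\<forall>i<n. Q i \<subset> Q (Suc i))}. enat n)"

definition regular_local_ring :: "('a, 'r) ring_scheme \<Rightarrow> bool"
  where "regular_local_ring R \<longleftrightarrow>
    cring R \<and> noetherian_ring R \<and>
    (\<exists>\<mm>. (\<forall>J. maximalideal J R \<longleftrightarrow> J = \<mm>) \<and>
      enat (LEAST n. \<exists>A\<subseteq>carrier R. finite A \<and> card A = n \<and> Idl\<^bsub>R\<^esub> A = \<mm>) = krull_dim R)"

text \<open>The pair \<open>(a, s)\<close> represents the fraction \<open>a / s\<close>. The extra factor \<open>u\<close> is needed because \<open>R\<close>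
  may have zero divisors.\<close>

definition fraction_rel :: "('a, 'r) ring_scheme \<Rightarrow> 'a set \<Rightarrow> (('a \<times> 'a) \<times> ('a \<times> 'a)) set"
  where "fraction_rel R P =
    {((a, s), (b, t)). a \<in> carrier R \<and> b \<in> carrier R \<and> s \<in> carrier R - P \<and> t \<in> carrier R - P \<and>
      (\<exists>u\<in>carrier R - P. u \<otimes>\<^bsub>R\<^esub> (a \<otimes>\<^bsub>R\<^esub> t) = u \<otimes>\<^bsub>R\<^esub> (b \<otimes>\<^bsub>R\<^esub> s))}"

text \<open>The unions below are over equal sets, since the operations do not depend on the choice of
  representatives: see \<open>fraction_add\<close> and \<open>fraction_mult\<close>.\<close>

definition localization_at :: "('a, 'r) ring_scheme \<Rightarrow> 'a set \<Rightarrow> ('a \<times> 'a) set ring"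
  where "localization_at R P =
    \<lparr>carrier = (carrier R \<times> (carrier R - P)) // fraction_rel R P,
     monoid.mult = (\<lambda>C D. \<Union>(a, s)\<in>C. \<Union>(b, t)\<in>D. fraction_rel R P `` {(a \<otimes>\<^bsub>R\<^esub> b, s \<otimes>\<^bsub>R\<^esub> t)}),
     one = fraction_rel R P `` {(\<one>\<^bsub>R\<^esub>, \<one>\<^bsub>R\<^esub>)},
     ring.zero = fraction_rel R P `` {(\<zero>\<^bsub>R\<^esub>, \<one>\<^bsub>R\<^esub>)},
     add = (\<lambda>C D. \<Union>(a, s)\<in>C. \<Union>(b, t)\<in>D.
       fraction_rel R P `` {(a \<otimes>\<^bsub>R\<^esub> t \<oplus>\<^bsub>R\<^esub> b \<otimes>\<^bsub>R\<^esub> s, s \<otimes>\<^bsub>R\<^esub> t)})\<rparr>"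

definition regular_ring :: "('a, 'r) ring_scheme \<Rightarrow> bool"
  where "regular_ring R \<longleftrightarrow>
    cring R \<and> noetherian_ring R \<and>
    (\<forall>P. primeideal P R \<longrightarrow> regular_local_ring (localization_at R P))"

context primeideal
begin

lemma denom_closed:
  assumes "s \<in> carrier R - I" "t \<in> carrier R - I"
  shows "s \<otimes> t \<in> carrier R - I"
  using assms I_prime by auto

lemma one_denom: "\<one> \<in> carrier R - I"
  using I_notcarr one_imp_carrier by auto

lemma equiv_fraction_rel: "equiv (carrier R \<times> (carrier R - I)) (fraction_rel R I)"
proof (rule equivI)
  show "refl_on (carrier R \<times> (carrier R - I)) (fraction_rel R I)"
    using one_denom unfolding refl_on_def fraction_rel_def by blast
  show "fraction_rel R I \<subseteq> (carrier R \<times> (carrier R - I)) \<times> (carrier R \<times> (carrier R - I))"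
    unfolding fraction_rel_def by auto
  show "sym (fraction_rel R I)"
    unfolding fraction_rel_def sym_def by clarsimp (metis DiffI)
  show "trans (fraction_rel R I)"
  proof (rule transI)
    fix x y z
    assume "(x, y) \<in> fraction_rel R I" "(y, z) \<in> fraction_rel R I"
    then obtain a s b t c r u v where xyz: "x = (a, s)" "y = (b, t)" "z = (c, r)"
      and c: "a \<in> carrier R" "b \<in> carrier R" "c \<in> carrier R"
      and d: "s \<in> carrier R - I" "t \<in> carrier R - I" "r \<in> carrier R - I"
        "u \<in> carrier R - I" "v \<in> carrier R - I"
      and e: "u \<otimes> (a \<otimes> t) = u \<otimes> (b \<otimes> s)" "v \<otimes> (b \<otimes> r) = v \<otimes> (c \<otimes> t)"
      unfolding fraction_rel_def by auto
    note cc = c d[THEN DiffD1]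
    have "(u \<otimes> v \<otimes> t) \<otimes> (a \<otimes> r) = (u \<otimes> (a \<otimes> t)) \<otimes> (v \<otimes> r)"
      using cc by algebra
    also have "\<dots> = (v \<otimes> (b \<otimes> r)) \<otimes> (u \<otimes> s)"
      using cc unfolding e(1) by algebra
    also have "\<dots> = (u \<otimes> v \<otimes> t) \<otimes> (c \<otimes> s)"
      using cc unfolding e(2) by algebra
    finally show "(x, z) \<in> fraction_rel R I"
      using c d denom_closed[OF denom_closed[OF d(4,5)] d(2)] unfolding xyz fraction_rel_def
      by blast
  qed
qed

lemma fraction_relI:
  assumes "a \<in> carrier R" "b \<in> carrier R" "s \<in> carrier R - I" "t \<in> carrier R - I"
    "u \<in> carrier R - I" "u \<otimes> (a \<otimes> t) = u \<otimes> (b \<otimes> s)"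
  shows "((a, s), (b, t)) \<in> fraction_rel R I"
  using assms unfolding fraction_rel_def by blast

lemma fraction_mult:
  assumes "a \<in> carrier R" "b \<in> carrier R" "s \<in> carrier R - I" "t \<in> carrier R - I"
  shows "fraction_rel R I `` {(a, s)} \<otimes>\<^bsub>localization_at R I\<^esub> fraction_rel R I `` {(b, t)} =
    fraction_rel R I `` {(a \<otimes> b, s \<otimes> t)}"
proof -
  let ?f = "\<lambda>x y. fraction_rel R I `` {(fst x \<otimes> fst y, snd x \<otimes> snd y)}"
  have "congruent2 (fraction_rel R I) (fraction_rel R I) ?f"
  proof (rule congruent2I')
    fix x x' y y'
    assume "(x, x') \<in> fraction_rel R I" "(y, y') \<in> fraction_rel R I"
    then obtain a s b t c r d q u v where xyz: "x = (a, s)" "x' = (b, t)" "y = (c, r)" "y' = (d, q)"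
      and c: "a \<in> carrier R" "b \<in> carrier R" "c \<in> carrier R" "d \<in> carrier R"
      and d: "s \<in> carrier R - I" "t \<in> carrier R - I" "r \<in> carrier R - I" "q \<in> carrier R - I"
        "u \<in> carrier R - I" "v \<in> carrier R - I"
      and e: "u \<otimes> (a \<otimes> t) = u \<otimes> (b \<otimes> s)" "v \<otimes> (c \<otimes> q) = v \<otimes> (d \<otimes> r)"
      unfolding fraction_rel_def by auto
    note cc = c d[THEN DiffD1]
    have "(u \<otimes> v) \<otimes> ((a \<otimes> c) \<otimes> (t \<otimes> q)) = (u \<otimes> (a \<otimes> t)) \<otimes> (v \<otimes> (c \<otimes> q))"
      using cc by algebra
    also have "\<dots> = (u \<otimes> v) \<otimes> ((b \<otimes> d) \<otimes> (s \<otimes> r))"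
      using cc unfolding e by algebra
    finally have "((a \<otimes> c, s \<otimes> r), (b \<otimes> d, t \<otimes> q)) \<in> fraction_rel R I"
      using c d by (intro fraction_relI[where u = "u \<otimes> v"] denom_closed m_closed) auto
    then show "?f x y = ?f x' y'"
      unfolding xyz fst_conv snd_conv by (rule equiv_class_eq[OF equiv_fraction_rel])
  qed
  from UN_equiv_class2[OF equiv_fraction_rel equiv_fraction_rel this, of "(a, s)" "(b, t)"] assms
  show ?thesis
    by (simp add: localization_at_def case_prod_beta)
qed

lemma fraction_add:
  assumes "a \<in> carrier R" "b \<in> carrier R" "s \<in> carrier R - I" "t \<in> carrier R - I"
  shows "fraction_rel R I `` {(a, s)} \<oplus>\<^bsub>localization_at R I\<^esub> fraction_rel R I `` {(b, t)} =
    fraction_rel R I `` {(a \<otimes> t \<oplus> b \<otimes> s, s \<otimes> t)}"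
proof -
  let ?f = "\<lambda>x y. fraction_rel R I `` {(fst x \<otimes> snd y \<oplus> fst y \<otimes> snd x, snd x \<otimes> snd y)}"
  have "congruent2 (fraction_rel R I) (fraction_rel R I) ?f"
  proof (rule congruent2I')
    fix x x' y y'
    assume "(x, x') \<in> fraction_rel R I" "(y, y') \<in> fraction_rel R I"
    then obtain a s b t c r d q u v where xyz: "x = (a, s)" "x' = (b, t)" "y = (c, r)" "y' = (d, q)"
      and c: "a \<in> carrier R" "b \<in> carrier R" "c \<in> carrier R" "d \<in> carrier R"
      and d: "s \<in> carrier R - I" "t \<in> carrier R - I" "r \<in> carrier R - I" "q \<in> carrier R - I"
        "u \<in> carrier R - I" "v \<in> carrier R - I"
      and e: "u \<otimes> (a \<otimes> t) = u \<otimes> (b \<otimes> s)" "v \<otimes> (c \<otimes> q) = v \<otimes> (d \<otimes> r)"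
      unfolding fraction_rel_def by auto
    note cc = c d[THEN DiffD1]
    have "(u \<otimes> v) \<otimes> ((a \<otimes> r \<oplus> c \<otimes> s) \<otimes> (t \<otimes> q)) =
        (u \<otimes> (a \<otimes> t)) \<otimes> (v \<otimes> r \<otimes> q) \<oplus> (v \<otimes> (c \<otimes> q)) \<otimes> (u \<otimes> s \<otimes> t)"
      using cc by algebra
    also have "\<dots> = (u \<otimes> v) \<otimes> ((b \<otimes> q \<oplus> d \<otimes> t) \<otimes> (s \<otimes> r))"
      using cc unfolding e by algebra
    finally have "((a \<otimes> r \<oplus> c \<otimes> s, s \<otimes> r), (b \<otimes> q \<oplus> d \<otimes> t, t \<otimes> q)) \<in> fraction_rel R I"
      using c d by (intro fraction_relI[where u = "u \<otimes> v"] denom_closed m_closed a_closed) auto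
    then show "?f x y = ?f x' y'"
      unfolding xyz fst_conv snd_conv by (rule equiv_class_eq[OF equiv_fraction_rel])
  qed
  from UN_equiv_class2[OF equiv_fraction_rel equiv_fraction_rel this, of "(a, s)" "(b, t)"] assms
  show ?thesis
    by (simp add: localization_at_def case_prod_beta)
qed

end

end

theory Submission
  imports Defs
begin

text \<open>The growth condition makes the \<open>I\<close>-torsion elements of every left \<open>S\<close>-module an \<open>S\<close>-submodule,
  for each ideal \<open>I\<close> of \<open>R\<close>. Since \<open>E\<close> is uniform, the torsion submodules of two associated primes
  \<open>P\<close>, \<open>P'\<close> share a nonzero element, and an associated prime containing its annihilator contains a
  power of each of \<open>P\<close>, \<open>P'\<close>, hence both. So \<open>Ass\<^sub>R E\<close> is directed, and as \<open>R\<close> is Noetherian it has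
  a greatest element \<open>P\<close>. By essentiality the \<open>P\<close>-torsion of \<open>E\<close> meets \<open>M\<close>, which yields an
  associated prime of \<open>M\<close> containing \<open>P\<close>, that is, \<open>P\<close> itself.\<close>

section \<open>Submodules\<close>

context left_module
begin

lemma smult_r_null [simp]: "a \<in> carrier R \<Longrightarrow> a \<odot>\<^bsub>M\<^esub> \<zero>\<^bsub>M\<^esub> = \<zero>\<^bsub>M\<^esub>"
  using smult_r_distr[of a "\<zero>\<^bsub>M\<^esub>" "\<zero>\<^bsub>M\<^esub>"] M.add.l_cancel_one' by force

lemma smult_l_null [simp]: "x \<in> carrier M \<Longrightarrow> \<zero> \<odot>\<^bsub>M\<^esub> x = \<zero>\<^bsub>M\<^esub>"
  using smult_l_distr[of "\<zero>" "\<zero>" x] M.add.l_cancel_one' by force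

lemma smult_minus_one:
  assumes "x \<in> carrier M"
  shows "(\<ominus> \<one>) \<odot>\<^bsub>M\<^esub> x = \<ominus>\<^bsub>M\<^esub> x"
proof -
  have "(\<ominus> \<one>) \<odot>\<^bsub>M\<^esub> x \<oplus>\<^bsub>M\<^esub> x = (\<ominus> \<one> \<oplus> \<one>) \<odot>\<^bsub>M\<^esub> x"
    using assms by (subst smult_l_distr) auto
  also have "\<dots> = \<zero>\<^bsub>M\<^esub>"
    using assms by (simp add: R.l_neg)
  finally show ?thesis
    using assms by (intro M.minus_equality[symmetric]) auto
qed

text \<open>Inverses are multiples by \<open>\<ominus> \<one>\<close>, so closure under scalars,
  together with zero and sums, already gives the subgroup property that the library's
  \<open>submodule\<close> asks for.\<close>

lemma submodule_iff:
  "submodule N R M \<longleftrightarrow> N \<subseteq> carrier M \<and> \<zero>\<^bsub>M\<^esub> \<in> N \<and> (\<forall>x\<in>N. \<forall>y\<in>N. x \<oplus>\<^bsub>M\<^esub> y \<in> N) \<and>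
    (\<forall>a\<in>carrier R. \<forall>x\<in>N. a \<odot>\<^bsub>M\<^esub> x \<in> N)" (is "?L \<longleftrightarrow> ?R")
proof
  assume ?L
  then interpret submodule N R M .
  show ?R
    using subset one_closed m_closed by auto
next
  assume N: ?R
  have "\<ominus>\<^bsub>M\<^esub> x \<in> N" if "x \<in> N" for x
    using N that smult_minus_one[of x] by (metis R.add.inv_closed R.one_closed subsetD)
  then show ?L
    using N by unfold_locales (auto simp flip: a_inv_def)
qed

lemma submoduleD:
  assumes "submodule N R M"
  shows "N \<subseteq> carrier M" "\<zero>\<^bsub>M\<^esub> \<in> N" "\<And>x y. x \<in> N \<Longrightarrow> y \<in> N \<Longrightarrow> x \<oplus>\<^bsub>M\<^esub> y \<in> N"
    "\<And>a x. a \<in> carrier R \<Longrightarrow> x \<in> N \<Longrightarrow> a \<odot>\<^bsub>M\<^esub> x \<in> N" "\<And>x. x \<in> N \<Longrightarrow> \<ominus>\<^bsub>M\<^esub> x \<in> N"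
    "\<And>x y. x \<in> N \<Longrightarrow> y \<in> N \<Longrightarrow> x \<ominus>\<^bsub>M\<^esub> y \<in> N"
proof -
  show N: "N \<subseteq> carrier M" "\<zero>\<^bsub>M\<^esub> \<in> N" "\<And>x y. x \<in> N \<Longrightarrow> y \<in> N \<Longrightarrow> x \<oplus>\<^bsub>M\<^esub> y \<in> N"
    "\<And>a x. a \<in> carrier R \<Longrightarrow> x \<in> N \<Longrightarrow> a \<odot>\<^bsub>M\<^esub> x \<in> N"
    using assms unfolding submodule_iff by auto
  show m: "\<ominus>\<^bsub>M\<^esub> x \<in> N" if "x \<in> N" for x
    using N that smult_minus_one[of x] by (metis R.add.inv_closed R.one_closed subsetD)
  show "x \<ominus>\<^bsub>M\<^esub> y \<in> N" if "x \<in> N" "y \<in> N" for x y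
    using N m that unfolding a_minus_def by blast
qed

lemma set_addI: "a \<in> A \<Longrightarrow> b \<in> B \<Longrightarrow> a \<oplus>\<^bsub>M\<^esub> b \<in> A <+>\<^bsub>M\<^esub> B"
  unfolding set_add_def' by blast

lemma submodule_set_add:
  assumes A: "submodule A R M" and B: "submodule B R M"
  shows "submodule (A <+>\<^bsub>M\<^esub> B) R M"
proof -
  note A = submoduleD[OF A] and B = submoduleD[OF B]
  have sub: "A <+>\<^bsub>M\<^esub> B \<subseteq> carrier M"
    using A(1) B(1) unfolding set_add_def' by auto
  moreover have "\<zero>\<^bsub>M\<^esub> \<in> A <+>\<^bsub>M\<^esub> B"
    using A(2) B(2) unfolding set_add_def' by force
  moreover have "x \<oplus>\<^bsub>M\<^esub> y \<in> A <+>\<^bsub>M\<^esub> B" if xy: "x \<in> A <+>\<^bsub>M\<^esub> B" "y \<in> A <+>\<^bsub>M\<^esub> B" for x y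
  proof -
    obtain a b a' b' where e: "x = a \<oplus>\<^bsub>M\<^esub> b" "y = a' \<oplus>\<^bsub>M\<^esub> b'"
      and i: "a \<in> A" "b \<in> B" "a' \<in> A" "b' \<in> B"
      using xy unfolding set_add_def' by auto
    have "x \<oplus>\<^bsub>M\<^esub> y = (a \<oplus>\<^bsub>M\<^esub> a') \<oplus>\<^bsub>M\<^esub> (b \<oplus>\<^bsub>M\<^esub> b')"
      using A(1) B(1) i unfolding e by (simp add: M.a_ac subset_iff)
    then show ?thesis
      using set_addI[OF A(3)[OF i(1,3)] B(3)[OF i(2,4)]] by simp
  qed
  moreover have "r \<odot>\<^bsub>M\<^esub> x \<in> A <+>\<^bsub>M\<^esub> B" if rx: "r \<in> carrier R" "x \<in> A <+>\<^bsub>M\<^esub> B" for r x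
  proof -
    obtain a b where e: "x = a \<oplus>\<^bsub>M\<^esub> b" and i: "a \<in> A" "b \<in> B"
      using rx unfolding set_add_def' by auto
    have "r \<odot>\<^bsub>M\<^esub> x = r \<odot>\<^bsub>M\<^esub> a \<oplus>\<^bsub>M\<^esub> r \<odot>\<^bsub>M\<^esub> b"
      using A(1) B(1) i rx(1) unfolding e by (intro smult_r_distr) auto
    then show ?thesis
      using set_addI[OF A(4)[OF rx(1) i(1)] B(4)[OF rx(1) i(2)]] by simp
  qed
  ultimately show ?thesis
    unfolding submodule_iff by blast
qed

text \<open>Zorn's lemma: the union of a nonempty chain of such submodules is again one. This
  supplies both complements in the proof of \<open>indecomposable_injective_uniform\<close>.\<close>

lemma submodule_maximal_disjoint:
  assumes N: "submodule N R M" and NY: "N \<inter> Y = {\<zero>\<^bsub>M\<^esub>}"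
  obtains C where "submodule C R M" "N \<subseteq> C" "C \<inter> Y = {\<zero>\<^bsub>M\<^esub>}"
    "\<And>D. submodule D R M \<Longrightarrow> C \<subseteq> D \<Longrightarrow> D \<inter> Y = {\<zero>\<^bsub>M\<^esub>} \<Longrightarrow> D = C"
proof -
  let ?F = "{C. submodule C R M \<and> N \<subseteq> C \<and> C \<inter> Y = {\<zero>\<^bsub>M\<^esub>}}"
  have "\<exists>C\<in>?F. \<forall>D\<in>?F. C \<subseteq> D \<longrightarrow> D = C"
  proof (rule subset_Zorn_nonempty)
    show "?F \<noteq> {}"
      using N NY by blast
    fix K assume K: "K \<noteq> {}" "subset.chain ?F K"
    then have KF: "K \<subseteq> ?F" and ch: "\<And>A B. A \<in> K \<Longrightarrow> B \<in> K \<Longrightarrow> A \<subseteq> B \<or> B \<subseteq> A"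
      unfolding subset_chain_def by auto
    have sm: "\<And>C. C \<in> K \<Longrightarrow> submodule C R M"
      using KF by auto
    note KD = submoduleD[OF sm]
    have "submodule (\<Union>K) R M"
      unfolding submodule_iff
    proof (intro conjI ballI)
      fix x y assume "x \<in> \<Union>K" "y \<in> \<Union>K"
      then obtain A B where "A \<in> K" "x \<in> A" "B \<in> K" "y \<in> B"
        by auto
      \<comment> \<open>Both elements lie in the larger of the two chain members.\<close>
      with ch[of A B] KD(3)[of A x y] KD(3)[of B x y] show "x \<oplus>\<^bsub>M\<^esub> y \<in> \<Union>K"
        by blast
    next
      show "\<Union>K \<subseteq> carrier M"
        using KD(1) by blast
      show "\<zero>\<^bsub>M\<^esub> \<in> \<Union>K"
        using KD(2) K(1) by blast
    next
      fix a x assume "a \<in> carrier R" "x \<in> \<Union>K"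
      then show "a \<odot>\<^bsub>M\<^esub> x \<in> \<Union>K"
        using KD(4) by (meson UnionE UnionI)
    qed
    moreover have "N \<subseteq> \<Union>K" "\<Union>K \<inter> Y = {\<zero>\<^bsub>M\<^esub>}"
      using K(1) KF by blast+
    ultimately show "\<Union>K \<in> ?F"
      by blast
  qed
  then obtain C where "C \<in> ?F" "\<forall>D\<in>?F. C \<subseteq> D \<longrightarrow> D = C" ..
  then show ?thesis
    by (intro that[of C]) auto
qed

end

section \<open>Module homomorphisms, with preimages and images of submodules\<close>

lemma module_homD:
  assumes "f \<in> module_hom R M N"
  shows "\<And>x. x \<in> carrier M \<Longrightarrow> f x \<in> carrier N"
    "\<And>x y. x \<in> carrier M \<Longrightarrow> y \<in> carrier M \<Longrightarrow> f (x \<oplus>\<^bsub>M\<^esub> y) = f x \<oplus>\<^bsub>N\<^esub> f y"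
    "\<And>a x. a \<in> carrier R \<Longrightarrow> x \<in> carrier M \<Longrightarrow> f (a \<odot>\<^bsub>M\<^esub> x) = a \<odot>\<^bsub>N\<^esub> f x"
  using assms unfolding module_hom_def by auto

lemma module_hom_zero:
  assumes M: "left_module R M" and N: "left_module R N" and f: "f \<in> module_hom R M N"
  shows "f \<zero>\<^bsub>M\<^esub> = \<zero>\<^bsub>N\<^esub>"
proof -
  interpret M: left_module R M by fact
  interpret N: left_module R N by fact
  have "f (\<zero>\<^bsub>R\<^esub> \<odot>\<^bsub>M\<^esub> \<zero>\<^bsub>M\<^esub>) = \<zero>\<^bsub>R\<^esub> \<odot>\<^bsub>N\<^esub> f \<zero>\<^bsub>M\<^esub>"
    by (intro module_homD[OF f]) auto
  then show ?thesis
    using module_homD(1)[OF f] by simp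
qed

lemma submodule_vimage:
  assumes M: "left_module R M" and N: "left_module R N" and f: "f \<in> module_hom R M N"
    and C: "submodule C R N"
  shows "submodule {x \<in> carrier M. f x \<in> C} R M"
proof -
  interpret M: left_module R M by fact
  interpret N: left_module R N by fact
  show ?thesis
    unfolding M.submodule_iff
    using N.submoduleD[OF C] module_homD[OF f] module_hom_zero[OF M N f] by auto
qed

lemma submodule_image:
  assumes M: "left_module R M" and N: "left_module R N" and f: "f \<in> module_hom R M N"
  shows "submodule (f ` carrier M) R N"
proof -
  interpret M: left_module R M by fact
  interpret N: left_module R N by fact
  have "f x \<oplus>\<^bsub>N\<^esub> f y \<in> f ` carrier M" if "x \<in> carrier M" "y \<in> carrier M" for x y
    using that module_homD(2)[OF f, of x y] by (metis M.a_closed imageI)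
  moreover have "a \<odot>\<^bsub>N\<^esub> f x \<in> f ` carrier M" if "a \<in> carrier R" "x \<in> carrier M" for a x
    using that module_homD(3)[OF f, of a x] by (metis M.smult_closed imageI)
  moreover have "\<zero>\<^bsub>N\<^esub> \<in> f ` carrier M"
    using module_hom_zero[OF M N f] by (metis M.zero_closed imageI)
  ultimately show ?thesis
    unfolding N.submodule_iff using module_homD(1)[OF f] by blast
qed


section \<open>Indecomposable injective modules are uniform\<close>

text \<open>A copy of \<open>A\<close> in the type of the test modules of \<^const>\<open>injective_module\<close>; the
  multiplicative fields are junk.\<close>

definition Inr_copy :: "('a, 'm, 'c) module_scheme \<Rightarrow> 'm set \<Rightarrow> ('a, 'a + 'm) module"
  where "Inr_copy M A =
    \<lparr>carrier = Inr ` A, monoid.mult = (\<lambda>x y. x), one = Inr \<zero>\<^bsub>M\<^esub>, ring.zero = Inr \<zero>\<^bsub>M\<^esub>,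
     add = (\<lambda>x y. Inr (projr x \<oplus>\<^bsub>M\<^esub> projr y)), smult = (\<lambda>a x. Inr (a \<odot>\<^bsub>M\<^esub> projr x))\<rparr>"

context left_module
begin

lemma left_module_Inr_copy:
  assumes "submodule A R M"
  shows "left_module R (Inr_copy M A)"
proof -
  note A = submoduleD[OF assms]
  have sub: "\<And>x. x \<in> A \<Longrightarrow> x \<in> carrier M"
    using A(1) by auto
  have "abelian_group (Inr_copy M A)"
  proof (rule abelian_groupI)
    fix x assume "x \<in> carrier (Inr_copy M A)"
    then obtain a where "x = Inr a" "a \<in> A"
      by (auto simp: Inr_copy_def)
    then show "\<exists>y\<in>carrier (Inr_copy M A). y \<oplus>\<^bsub>Inr_copy M A\<^esub> x = \<zero>\<^bsub>Inr_copy M A\<^esub>"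
      using A(5) by (auto simp: Inr_copy_def sub M.l_neg intro!: bexI[of _ "\<ominus>\<^bsub>M\<^esub> a"])
  qed (use A(2,3) in \<open>auto simp: Inr_copy_def sub M.a_assoc intro: M.a_comm\<close>)
  then show ?thesis
    using R.ring_axioms A(4)
    by (auto simp: left_module_def left_module_axioms_def Inr_copy_def sub
        smult_l_distr smult_r_distr smult_assoc1)
qed

text \<open>Injectivity of \<open>M\<close> is tested on modules with carrier in
  \<open>'a + 'm\<close>. So the inclusion of \<open>A\<close> into \<open>M\<close> is moved to the
  copies under \<open>Inr\<close>, where it becomes \<open>id\<close>, and the extension found there
  is composed with \<open>Inr\<close>.\<close>

lemma injective_module_extend:
  assumes inj: "injective_module R M" and A: "submodule A R M"
    and g: "g \<in> module_hom R (M\<lparr>carrier := A\<rparr>) M"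
  obtains h where "h \<in> module_hom R M M" "\<And>x. x \<in> A \<Longrightarrow> h x = g x"
proof -
  let ?A = "Inr_copy M A" and ?M = "Inr_copy M (carrier M)"
  have M: "submodule (carrier M) R M"
    unfolding submodule_iff by auto
  have sub: "\<And>x. x \<in> A \<Longrightarrow> x \<in> carrier M"
    using submoduleD(1)[OF A] by auto
  have "id \<in> module_hom R ?A ?M"
    using sub by (auto simp: module_hom_def Inr_copy_def)
  moreover have "g \<circ> projr \<in> module_hom R ?A M"
    using module_homD[OF g] by (auto simp: module_hom_def Inr_copy_def)
  ultimately obtain h where h: "h \<in> module_hom R ?M M"
    and hg: "\<And>x. x \<in> carrier ?A \<Longrightarrow> h (id x) = (g \<circ> projr) x"
    using inj left_module_Inr_copy[OF A] left_module_Inr_copy[OF M] inj_on_id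
    unfolding injective_module_def by meson
  have h': "h (Inr x) \<in> carrier M" "h (Inr (x \<oplus>\<^bsub>M\<^esub> y)) = h (Inr x) \<oplus>\<^bsub>M\<^esub> h (Inr y)"
    "h (Inr (a \<odot>\<^bsub>M\<^esub> x)) = a \<odot>\<^bsub>M\<^esub> h (Inr x)"
    if "x \<in> carrier M" "y \<in> carrier M" "a \<in> carrier R" for x y a
    using module_homD(1)[OF h, of "Inr x"] module_homD(2)[OF h, of "Inr x" "Inr y"]
      module_homD(3)[OF h, of a "Inr x"] that by (auto simp: Inr_copy_def)
  have "h \<circ> Inr \<in> module_hom R M M"
    using h'[OF _ M.zero_closed R.zero_closed] h'(2)[OF _ _ R.zero_closed] h'(3)[OF _ M.zero_closed]
    by (auto simp: module_hom_def)
  moreover have "(h \<circ> Inr) x = g x" if "x \<in> A" for x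
    using hg[of "Inr x"] that by (auto simp: Inr_copy_def)
  ultimately show ?thesis
    by (rule that)
qed

text \<open>Since \<open>A \<inter> C\<close> is trivial, the \<open>A\<close>-component of an
  element of the sum is unique, so choosing one gives a homomorphism. Its codomain is all of
  \<open>M\<close>, the form in which \<open>injective_module_extend\<close> takes its map.\<close>

lemma direct_sum_projection:
  assumes A: "submodule A R M" and C: "submodule C R M" and AC: "A \<inter> C = {\<zero>\<^bsub>M\<^esub>}"
  obtains g where "g \<in> module_hom R (M\<lparr>carrier := A <+>\<^bsub>M\<^esub> C\<rparr>) M"
    "\<And>a c. a \<in> A \<Longrightarrow> c \<in> C \<Longrightarrow> g (a \<oplus>\<^bsub>M\<^esub> c) = a"
proof -
  note A = submoduleD[OF A] and C = submoduleD[OF C]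
  have sA: "\<And>x. x \<in> A \<Longrightarrow> x \<in> carrier M" and sC: "\<And>x. x \<in> C \<Longrightarrow> x \<in> carrier M"
    using A(1) C(1) by auto
  define g where "g x = (SOME a. a \<in> A \<and> (\<exists>c\<in>C. x = a \<oplus>\<^bsub>M\<^esub> c))" for x
  have uniq: "a = a'" if i: "a \<in> A" "c \<in> C" "a' \<in> A" "c' \<in> C"
    and e: "a \<oplus>\<^bsub>M\<^esub> c = a' \<oplus>\<^bsub>M\<^esub> c'" for a c a' c'
  proof -
    note car = sA[OF i(1)] sC[OF i(2)] sA[OF i(3)] sC[OF i(4)]
    \<comment> \<open>The difference of the two \<open>A\<close>-components equals the difference
      \<open>c' \<ominus> c\<close> of the \<open>C\<close>-components, hence lies in
      \<open>A \<inter> C\<close>.\<close>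
    have "a \<ominus>\<^bsub>M\<^esub> a' = (a \<oplus>\<^bsub>M\<^esub> c) \<ominus>\<^bsub>M\<^esub> c \<ominus>\<^bsub>M\<^esub> a'"
      using car by (simp add: a_minus_def M.a_assoc M.r_neg)
    also have "\<dots> = (a' \<oplus>\<^bsub>M\<^esub> (c' \<ominus>\<^bsub>M\<^esub> c)) \<ominus>\<^bsub>M\<^esub> a'"
      using car by (simp add: e a_minus_def M.a_assoc)
    also have "\<dots> = c' \<ominus>\<^bsub>M\<^esub> c"
      using car M.a_comm[of a' "c' \<ominus>\<^bsub>M\<^esub> c"] by (simp add: a_minus_def M.a_assoc M.r_neg)
    finally have "a \<ominus>\<^bsub>M\<^esub> a' \<in> A \<inter> C"
      using A(6)[OF i(1,3)] C(6)[OF i(4,2)] by simp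
    then show ?thesis
      using AC car M.minus_equality[of a "\<ominus>\<^bsub>M\<^esub> a'"] by (simp add: a_minus_def)
  qed
  have g: "g (a \<oplus>\<^bsub>M\<^esub> c) = a" if "a \<in> A" "c \<in> C" for a c
    unfolding g_def
  proof (rule some_equality)
    show "a \<in> A \<and> (\<exists>d\<in>C. a \<oplus>\<^bsub>M\<^esub> c = a \<oplus>\<^bsub>M\<^esub> d)"
      using that by blast
  qed (use that uniq in blast)
  have "g \<in> module_hom R (M\<lparr>carrier := A <+>\<^bsub>M\<^esub> C\<rparr>) M"
    unfolding module_hom_def
  proof (intro CollectI conjI ballI)
    show "g \<in> carrier (M\<lparr>carrier := A <+>\<^bsub>M\<^esub> C\<rparr>) \<rightarrow> carrier M"
      using sA by (auto simp: set_add_def' g)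
  next
    fix x y assume "x \<in> carrier (M\<lparr>carrier := A <+>\<^bsub>M\<^esub> C\<rparr>)" "y \<in> carrier (M\<lparr>carrier := A <+>\<^bsub>M\<^esub> C\<rparr>)"
    then obtain a b a' b' where e: "x = a \<oplus>\<^bsub>M\<^esub> b" "y = a' \<oplus>\<^bsub>M\<^esub> b'"
      and i: "a \<in> A" "b \<in> C" "a' \<in> A" "b' \<in> C"
      by (auto simp: set_add_def')
    have "x \<oplus>\<^bsub>M\<^esub> y = (a \<oplus>\<^bsub>M\<^esub> a') \<oplus>\<^bsub>M\<^esub> (b \<oplus>\<^bsub>M\<^esub> b')"
      using i unfolding e by (simp add: M.a_ac sA sC)
    then show "g (x \<oplus>\<^bsub>M\<lparr>carrier := A <+>\<^bsub>M\<^esub> C\<rparr>\<^esub> y) = g x \<oplus>\<^bsub>M\<^esub> g y"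
      using i by (simp add: e g A(3) C(3))
  next
    fix r x assume r: "r \<in> carrier R" and "x \<in> carrier (M\<lparr>carrier := A <+>\<^bsub>M\<^esub> C\<rparr>)"
    then obtain a b where e: "x = a \<oplus>\<^bsub>M\<^esub> b" and i: "a \<in> A" "b \<in> C"
      by (auto simp: set_add_def')
    then show "g (r \<odot>\<^bsub>M\<lparr>carrier := A <+>\<^bsub>M\<^esub> C\<rparr>\<^esub> x) = r \<odot>\<^bsub>M\<^esub> g x"
      using r by (simp add: smult_r_distr sA sC g A(4) C(4))
  qed
  then show ?thesis
    using g by (rule that)
qed

end

text \<open>If \<open>C\<close> is maximal with \<open>C \<inter> A = 0\<close> and \<open>A' \<supseteq> A\<close> is maximal with \<open>A' \<inter> C = 0\<close>, then an
  endomorphism \<open>h\<close> extending the projection \<open>A' \<oplus> C \<rightarrow> A'\<close> satisfies \<open>h\<^sup>-\<^sup>1(C) = C\<close> and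
  \<open>h(M) = A'\<close> by maximality, so \<open>M = A' \<oplus> C\<close>.\<close>

lemma indecomposable_injective_uniform:
  assumes inj: "injective_module R M" and ind: "indecomposable_module R M"
    and A: "submodule A R M" and B: "submodule B R M" and AB: "A \<inter> B = {\<zero>\<^bsub>M\<^esub>}"
  shows "A = {\<zero>\<^bsub>M\<^esub>} \<or> B = {\<zero>\<^bsub>M\<^esub>}"
proof -
  interpret left_module R M
    using inj unfolding injective_module_def by blast
  note M = left_module_axioms
  \<comment> \<open>It suffices to treat a larger pair: if \<open>A'\<close> or \<open>C\<close> is
    zero, then so is \<open>A\<close> or \<open>B\<close>.\<close>
  obtain C where C: "submodule C R M" "B \<subseteq> C" "C \<inter> A = {\<zero>\<^bsub>M\<^esub>}"
    and C_max: "\<And>D. submodule D R M \<Longrightarrow> C \<subseteq> D \<Longrightarrow> D \<inter> A = {\<zero>\<^bsub>M\<^esub>} \<Longrightarrow> D = C"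
    using submodule_maximal_disjoint[OF B, of A] AB by (metis Int_commute)
  obtain A' where A': "submodule A' R M" "A \<subseteq> A'" "A' \<inter> C = {\<zero>\<^bsub>M\<^esub>}"
    and A'_max: "\<And>D. submodule D R M \<Longrightarrow> A' \<subseteq> D \<Longrightarrow> D \<inter> C = {\<zero>\<^bsub>M\<^esub>} \<Longrightarrow> D = A'"
    using submodule_maximal_disjoint[OF A, of C] C(3) by (metis Int_commute)
  note CD = submoduleD[OF C(1)] and AD = submoduleD[OF A'(1)]
  obtain g where g: "g \<in> module_hom R (M\<lparr>carrier := A' <+>\<^bsub>M\<^esub> C\<rparr>) M"
    and g_eq: "\<And>a c. a \<in> A' \<Longrightarrow> c \<in> C \<Longrightarrow> g (a \<oplus>\<^bsub>M\<^esub> c) = a"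
    using direct_sum_projection[OF A'(1) C(1) A'(3)] by blast
  obtain h where h: "h \<in> module_hom R M M" and hg: "\<And>x. x \<in> A' <+>\<^bsub>M\<^esub> C \<Longrightarrow> h x = g x"
    using injective_module_extend[OF inj submodule_set_add[OF A'(1) C(1)] g] by blast
  note hD = module_homD[OF h]
  have h_sum: "h (a \<oplus>\<^bsub>M\<^esub> c) = a" if "a \<in> A'" "c \<in> C" for a c
    using that g_eq[of a c] hg[OF set_addI] by simp
  have hA: "h a = a" if "a \<in> A'" for a
    using h_sum[OF that CD(2)] that AD(1) by (simp add: subset_iff)
  have hC: "h c = \<zero>\<^bsub>M\<^esub>" if "c \<in> C" for c
    using h_sum[OF AD(2) that] that CD(1) by (simp add: subset_iff)
  \<comment> \<open>The preimage contains \<open>C\<close> because \<open>h\<close> kills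
    \<open>C\<close>, and it meets \<open>A\<close> trivially because \<open>h\<close> fixes
    \<open>A\<close>, so the maximality of \<open>C\<close> applies.\<close>
  have vimage_C: "{x \<in> carrier M. h x \<in> C} = C"
  proof (rule C_max)
    show "submodule {x \<in> carrier M. h x \<in> C} R M"
      by (rule submodule_vimage[OF M M h C(1)])
    show "C \<subseteq> {x \<in> carrier M. h x \<in> C}"
      using hC CD by auto
    show "{x \<in> carrier M. h x \<in> C} \<inter> A = {\<zero>\<^bsub>M\<^esub>}"
    proof
      have "x = \<zero>\<^bsub>M\<^esub>" if "x \<in> A" "h x \<in> C" for x
      proof -
        have "x \<in> C \<inter> A"
          using that hA[OF subsetD[OF A'(2) that(1)]] by simp
        then show ?thesis
          unfolding C(3) by simp
      qed
      then show "{x \<in> carrier M. h x \<in> C} \<inter> A \<subseteq> {\<zero>\<^bsub>M\<^esub>}"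
        by blast
      show "{\<zero>\<^bsub>M\<^esub>} \<subseteq> {x \<in> carrier M. h x \<in> C} \<inter> A"
        using hC[OF CD(2)] CD(2) submoduleD(2)[OF A] by simp
    qed
  qed
  \<comment> \<open>If \<open>h e\<close> lies in \<open>C\<close>, then \<open>e\<close> lies in
    the preimage of \<open>C\<close>, which is \<open>C\<close>, and \<open>h\<close> kills it. So
    the image, which contains \<open>A'\<close>, meets \<open>C\<close> only in zero.\<close>
  have im_h: "h ` carrier M = A'"
  proof (rule A'_max)
    show "submodule (h ` carrier M) R M"
      by (rule submodule_image[OF M M h])
    show "A' \<subseteq> h ` carrier M"
      using hA AD(1) by (force simp: image_iff)
    have "h e = \<zero>\<^bsub>M\<^esub>" if "e \<in> carrier M" "h e \<in> C" for e
      using vimage_C hC that by blast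
    moreover have "\<zero>\<^bsub>M\<^esub> \<in> h ` carrier M"
      using hC[OF CD(2)] by (metis M.zero_closed imageI)
    ultimately show "h ` carrier M \<inter> C = {\<zero>\<^bsub>M\<^esub>}"
      using CD(2) by auto
  qed
  have "A' <+>\<^bsub>M\<^esub> C = carrier M"
  proof
    show "A' <+>\<^bsub>M\<^esub> C \<subseteq> carrier M"
      using submoduleD(1)[OF submodule_set_add[OF A'(1) C(1)]] .
    show "carrier M \<subseteq> A' <+>\<^bsub>M\<^esub> C"
    proof
      fix e assume e: "e \<in> carrier M"
      then have he: "h e \<in> A'" "h e \<in> carrier M"
        using im_h hD(1) by auto
      \<comment> \<open>Every \<open>e\<close> splits as \<open>h e\<close> plus \<open>d\<close>.
        Since \<open>h\<close> fixes \<open>h e\<close>, it kills \<open>d\<close>, which puts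
        \<open>d\<close> into the preimage of \<open>C\<close>, that is, into
        \<open>C\<close>.\<close>
      define d where "d = \<ominus>\<^bsub>M\<^esub> h e \<oplus>\<^bsub>M\<^esub> e"
      have d: "d \<in> carrier M"
        using e he by (auto simp: d_def)
      have "h d = h (\<ominus>\<^bsub>M\<^esub> h e) \<oplus>\<^bsub>M\<^esub> h e"
        unfolding d_def using e he by (intro hD(2)) auto
      also have "\<dots> = \<zero>\<^bsub>M\<^esub>"
        using he hA[OF AD(5)] by (simp add: M.l_neg)
      finally have "d \<in> {x \<in> carrier M. h x \<in> C}"
        using d CD(2) by simp
      then have "d \<in> C"
        unfolding vimage_C .
      moreover have "e = h e \<oplus>\<^bsub>M\<^esub> d"
        using e he by (simp add: d_def M.r_neg2)
      ultimately show "e \<in> A' <+>\<^bsub>M\<^esub> C"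
        using set_addI[OF he(1)] by metis
    qed
  qed
  then have "A' = {\<zero>\<^bsub>M\<^esub>} \<or> C = {\<zero>\<^bsub>M\<^esub>}"
    using ind A'(1,3) C(1) unfolding indecomposable_module_def by blast
  then show ?thesis
    using A'(2) C(2) submoduleD(2)[OF A] submoduleD(2)[OF B] by blast
qed


section \<open>Associated primes over a commutative Noetherian ring\<close>

text \<open>The ascending chain condition makes the union of a nonempty chain of ideals a member of
  the chain, so Zorn's lemma applies to any nonempty family of ideals.\<close>

lemma (in noetherian_ring) maximal_ideal_in_family:
  assumes "F \<noteq> {}" "\<And>I. I \<in> F \<Longrightarrow> ideal I R"
  shows "\<exists>I\<in>F. \<forall>J\<in>F. I \<subseteq> J \<longrightarrow> J = I"
proof (rule subset_Zorn_nonempty)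
  fix K assume K: "K \<noteq> {}" "subset.chain F K"
  then have "subset.chain {I. ideal I R} K"
    using assms(2) unfolding subset_chain_def by auto
  from ideal_chain_is_trivial[OF K(1) this] K(2) show "\<Union>K \<in> F"
    unfolding subset_chain_def by auto
qed fact

definition annihilator :: "('a, 'r) ring_scheme \<Rightarrow> ('a, 'm, 'c) module_scheme \<Rightarrow> 'm \<Rightarrow> 'a set"
  where "annihilator R M x = {a \<in> carrier R. a \<odot>\<^bsub>M\<^esub> x = \<zero>\<^bsub>M\<^esub>}"

lemma Ass_iff:
  "Q \<in> Ass R M \<longleftrightarrow> primeideal Q R \<and> (\<exists>x\<in>carrier M. Q = annihilator R M x)"
  unfolding Ass_def annihilator_def by simp

text \<open>The annihilator is the kernel of the left linear map
  \<open>a \<mapsto> a \<odot> x\<close>. Over \<open>S\<close> this lets the left ideal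
  \<open>S J\<close> annihilate \<open>x\<close> as soon as \<open>J\<close> does.\<close>

lemma (in left_module) left_ideal_annihilator:
  assumes "x \<in> carrier M"
  shows "left_ideal (annihilator R M x) R"
proof -
  have "\<ominus> a \<in> annihilator R M x" if "a \<in> annihilator R M x" for a
  proof -
    have a: "a \<in> carrier R" "a \<odot>\<^bsub>M\<^esub> x = \<zero>\<^bsub>M\<^esub>"
      using that by (auto simp: annihilator_def)
    have "\<ominus> a = (\<ominus> \<one>) \<otimes> a"
      using a by (simp add: R.l_minus)
    then have "(\<ominus> a) \<odot>\<^bsub>M\<^esub> x = \<zero>\<^bsub>M\<^esub>"
      using a assms by (simp add: smult_assoc1)
    then show ?thesis
      using a by (simp add: annihilator_def)
  qed
  then have "subgroup (annihilator R M x) (add_monoid R)"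
    using assms by unfold_locales (auto simp: annihilator_def smult_l_distr simp flip: a_inv_def)
  then show ?thesis
    using assms unfolding left_ideal_def additive_subgroup_def
    by (auto simp: annihilator_def smult_assoc1)
qed

locale noetherian_module = module R M + noetherian_ring R
  for R :: "('a, 'r) ring_scheme" (structure) and M :: "('a, 'm, 'c) module_scheme" (structure)
begin

sublocale left_module R M
  using module_axioms module_iff_left_module by blast

lemma ideal_annihilator:
  assumes "x \<in> carrier M"
  shows "ideal (annihilator R M x) R"
proof (rule idealI)
  have l: "left_ideal (annihilator R M x) R"
    using left_ideal_annihilator[OF assms] .
  then show "subgroup (annihilator R M x) (add_monoid R)"
    and "\<And>a b. a \<in> annihilator R M x \<Longrightarrow> b \<in> carrier R \<Longrightarrow> b \<otimes> a \<in> annihilator R M x"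
    unfolding left_ideal_def additive_subgroup_def by auto
  then show "\<And>a b. a \<in> annihilator R M x \<Longrightarrow> b \<in> carrier R \<Longrightarrow> a \<otimes> b \<in> annihilator R M x"
    by (metis (no_types, lifting) annihilator_def m_comm mem_Collect_eq)
qed (rule R.ring_axioms)

text \<open>By the Noetherian condition some annihilator is maximal among those of the nonzero
  multiples of \<open>x\<close>, and such an annihilator is prime. Commutativity puts
  \<open>annihilator R M x\<close> inside each of them.\<close>

lemma exists_associated_prime:
  assumes x: "x \<in> carrier M" "x \<noteq> \<zero>\<^bsub>M\<^esub>"
  shows "\<exists>Q\<in>Ass R M. annihilator R M x \<subseteq> Q"
proof -
  define F where "F = {annihilator R M (r \<odot>\<^bsub>M\<^esub> x) |r. r \<in> carrier R \<and> r \<odot>\<^bsub>M\<^esub> x \<noteq> \<zero>\<^bsub>M\<^esub>}"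
  have "annihilator R M (\<one> \<odot>\<^bsub>M\<^esub> x) \<in> F"
    unfolding F_def using x by force
  then have "F \<noteq> {}"
    by blast
  moreover have "ideal I R" if "I \<in> F" for I
    using that x ideal_annihilator unfolding F_def by auto
  ultimately obtain Q where "Q \<in> F" and Q_max: "\<And>J. J \<in> F \<Longrightarrow> Q \<subseteq> J \<Longrightarrow> J = Q"
    using maximal_ideal_in_family by metis
  then obtain r where r: "r \<in> carrier R" "r \<odot>\<^bsub>M\<^esub> x \<noteq> \<zero>\<^bsub>M\<^esub>"
    and Q: "Q = annihilator R M (r \<odot>\<^bsub>M\<^esub> x)"
    unfolding F_def by auto
  have rx: "r \<odot>\<^bsub>M\<^esub> x \<in> carrier M"
    using r x by auto
  have "primeideal Q R"
  proof (rule primeidealI)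
    show "ideal Q R"
      unfolding Q by (rule ideal_annihilator[OF rx])
    show "cring R"
      by (rule R.is_cring)
    show "carrier R \<noteq> Q"
    proof
      assume "carrier R = Q"
      then have "\<one> \<odot>\<^bsub>M\<^esub> (r \<odot>\<^bsub>M\<^esub> x) = \<zero>\<^bsub>M\<^esub>"
        using Q unfolding annihilator_def by blast
      then show False
        using r rx by simp
    qed
    fix a b assume a: "a \<in> carrier R" and b: "b \<in> carrier R" and ab: "a \<otimes> b \<in> Q"
    show "a \<in> Q \<or> b \<in> Q"
    proof (cases "b \<odot>\<^bsub>M\<^esub> (r \<odot>\<^bsub>M\<^esub> x) = \<zero>\<^bsub>M\<^esub>")
      case True
      then show ?thesis
        using b by (simp add: Q annihilator_def)
    next
      case False
      \<comment> \<open>Multiplying by \<open>b\<close> can only enlarge the annihilator, so by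
        maximality \<open>b r x\<close> still has annihilator \<open>Q\<close>; and \<open>a\<close>
        kills \<open>b r x\<close> because \<open>a b\<close> kills \<open>r x\<close>.\<close>
      have e: "(b \<otimes> r) \<odot>\<^bsub>M\<^esub> x = b \<odot>\<^bsub>M\<^esub> (r \<odot>\<^bsub>M\<^esub> x)"
        using b r x by (simp add: smult_assoc1)
      have "annihilator R M ((b \<otimes> r) \<odot>\<^bsub>M\<^esub> x) \<in> F"
        unfolding F_def using False b r(1) e by (intro CollectI exI[of _ "b \<otimes> r"]) auto
      moreover have "Q \<subseteq> annihilator R M ((b \<otimes> r) \<odot>\<^bsub>M\<^esub> x)"
      proof
        fix q assume q: "q \<in> Q"
        then have qc: "q \<in> carrier R" "q \<odot>\<^bsub>M\<^esub> (r \<odot>\<^bsub>M\<^esub> x) = \<zero>\<^bsub>M\<^esub>"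
          by (auto simp: Q annihilator_def)
        have "q \<odot>\<^bsub>M\<^esub> (b \<odot>\<^bsub>M\<^esub> (r \<odot>\<^bsub>M\<^esub> x)) = b \<odot>\<^bsub>M\<^esub> (q \<odot>\<^bsub>M\<^esub> (r \<odot>\<^bsub>M\<^esub> x))"
          using qc(1) b rx by (simp add: m_comm flip: smult_assoc1)
        then show "q \<in> annihilator R M ((b \<otimes> r) \<odot>\<^bsub>M\<^esub> x)"
          unfolding e using qc b by (simp add: annihilator_def)
      qed
      ultimately have "annihilator R M ((b \<otimes> r) \<odot>\<^bsub>M\<^esub> x) = Q"
        by (rule Q_max)
      moreover have "a \<in> annihilator R M ((b \<otimes> r) \<odot>\<^bsub>M\<^esub> x)"
        using ab a b rx unfolding Q e by (simp add: annihilator_def smult_assoc1)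
      ultimately show ?thesis
        by blast
    qed
  qed
  moreover have "annihilator R M x \<subseteq> Q"
  proof
    fix q assume "q \<in> annihilator R M x"
    then have q: "q \<in> carrier R" "q \<odot>\<^bsub>M\<^esub> x = \<zero>\<^bsub>M\<^esub>"
      by (auto simp: annihilator_def)
    have "q \<odot>\<^bsub>M\<^esub> (r \<odot>\<^bsub>M\<^esub> x) = r \<odot>\<^bsub>M\<^esub> (q \<odot>\<^bsub>M\<^esub> x)"
      using q(1) r(1) x by (simp add: m_comm flip: smult_assoc1)
    then show "q \<in> Q"
      using q r(1) by (simp add: Q annihilator_def)
  qed
  moreover have "\<exists>y\<in>carrier M. Q = annihilator R M y"
    using Q rx ..
  ultimately show ?thesis
    by (intro bexI[of _ Q]) (simp_all add: Ass_iff)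
qed

end


section \<open>Powers of ideals\<close>

context cring
begin

text \<open>Powers of ideals are powers in the commutative monoid \<open>ideals_set R\<close> of
  ideals under the ideal product, whose unit is \<open>carrier R\<close>.\<close>

lemma ideal_ideal_pow:
  assumes "ideal I R"
  shows "ideal (I [^]\<^bsub>ideals_set R\<^esub> (n::nat)) R"
proof -
  interpret I: comm_monoid "ideals_set R"
    by (rule ideals_set_is_comm_monoid)
  show ?thesis
    using I.nat_pow_closed[of I n] assms by (simp add: ideals_set_def)
qed

lemma ideal_pow_pow:
  assumes "ideal I R"
  shows "(I [^]\<^bsub>ideals_set R\<^esub> (n::nat)) [^]\<^bsub>ideals_set R\<^esub> (m::nat) = I [^]\<^bsub>ideals_set R\<^esub> (n * m)"
proof -
  interpret I: comm_monoid "ideals_set R"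
    by (rule ideals_set_is_comm_monoid)
  show ?thesis
    using I.nat_pow_pow[of I n m] assms by (simp add: ideals_set_def)
qed

text \<open>The left-hand side is the product of the two powers, and a product of ideals lies in
  their intersection.\<close>

lemma ideal_pow_add_subset:
  assumes "ideal I R"
  shows "I [^]\<^bsub>ideals_set R\<^esub> (n + m :: nat) \<subseteq> I [^]\<^bsub>ideals_set R\<^esub> n \<inter> I [^]\<^bsub>ideals_set R\<^esub> m"
proof -
  interpret I: comm_monoid "ideals_set R"
    by (rule ideals_set_is_comm_monoid)
  have "I [^]\<^bsub>ideals_set R\<^esub> (n + m) = ideal_prod R (I [^]\<^bsub>ideals_set R\<^esub> n) (I [^]\<^bsub>ideals_set R\<^esub> m)"
    using I.nat_pow_mult[of I n m] assms by (simp add: ideals_set_def)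
  then show ?thesis
    using ideal_prod_inter[OF ideal_ideal_pow[OF assms] ideal_ideal_pow[OF assms]] by simp
qed

end

text \<open>Induction on \<open>n\<close>: if some \<open>a\<close> in \<open>J\<close> is outside
  the prime \<open>I\<close>, then \<open>b \<otimes> a \<in> I\<close> for \<open>b\<close> in
  \<open>J^n\<close> forces \<open>b\<close> into \<open>I\<close>, and the exponent drops by
  one.\<close>

lemma (in primeideal) ideal_pow_subset_imp_subset:
  assumes J: "ideal J R" and sub: "J [^]\<^bsub>ideals_set R\<^esub> (n::nat) \<subseteq> I"
  shows "J \<subseteq> I"
  using sub
proof (induction n)
  \<comment> \<open>The zeroth power is the whole ring, so the premise itself puts every element
    into \<open>I\<close>.\<close>
  case 0
  then have "carrier R \<subseteq> I"
    by (simp add: nat_pow_def ideals_set_def)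
  then show ?case
    using ideal.Icarr[OF J] by blast
next
  case (Suc n)
  let ?K = "J [^]\<^bsub>ideals_set R\<^esub> n"
  have prod: "ideal_prod R ?K J \<subseteq> I"
    using Suc.prems by (simp add: nat_pow_def ideals_set_def)
  show ?case
  proof (rule ccontr)
    assume "\<not> J \<subseteq> I"
    then obtain a where a: "a \<in> J" "a \<notin> I"
      by blast
    have "?K \<subseteq> I"
    proof
      fix b assume b: "b \<in> ?K"
      then have "b \<otimes> a \<in> I"
        using prod ideal_prod.prod[OF b a(1)] by blast
      then show "b \<in> I"
        using a(2) I_prime[OF ideal.Icarr[OF ideal_ideal_pow[OF J] b] ideal.Icarr[OF J a(1)]] by blast
    qed
    from Suc.IH[OF this] show False
      using a by blast
  qed
qed


section \<open>Torsion submodules\<close>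

text \<open>The \<open>I\<close>-torsion functor \<open>\<Gamma>_I\<close>, also known as zeroth
  local cohomology. In a module the exponent 0 admits only the zero element, since
  \<open>I^0\<close> contains the identity.\<close>

definition torsion :: "('a, 'r) ring_scheme \<Rightarrow> ('a, 'm, 'c) module_scheme \<Rightarrow> 'a set \<Rightarrow> 'm set"
  where "torsion R M I =
    {x \<in> carrier M. \<exists>n::nat. I [^]\<^bsub>ideals_set R\<^esub> n \<subseteq> annihilator R M x}"

lemma left_module_restrict:
  assumes "left_module S M" "subring R S"
  shows "left_module (S\<lparr>carrier := R\<rparr>) M"
proof -
  interpret left_module S M by fact
  show ?thesis
    using R.subring_is_ring[OF assms(2)] M.abelian_group_axioms subringE(1)[OF assms(2)]
    by (auto simp: left_module_def left_module_axioms_def smult_l_distr smult_r_distr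
        smult_assoc1 subset_iff)
qed

text \<open>The condition \<open>J\<^sup>r s \<subseteq> S J\<close> is applied to \<open>J = I\<^sup>n\<close>, where \<open>I\<^sup>n\<close> annihilates \<open>x\<close>: then \<open>S J\<close>
  annihilates \<open>x\<close>, so \<open>I\<^sup>n\<^sup>r\<close> annihilates \<open>s x\<close>.\<close>

lemma submodule_torsion:
  assumes M: "left_module S M" and R: "subring R S" and cR: "cring (S\<lparr>carrier := R\<rparr>)"
    and pow: "\<And>J s. ideal J (S\<lparr>carrier := R\<rparr>) \<Longrightarrow> s \<in> carrier S \<Longrightarrow>
      \<exists>r\<ge>1::nat. (\<lambda>a. a \<otimes>\<^bsub>S\<^esub> s) ` (J [^]\<^bsub>ideals_set (S\<lparr>carrier := R\<rparr>)\<^esub> r) \<subseteq> left_ideal_gen S J"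
    and I: "ideal I (S\<lparr>carrier := R\<rparr>)"
  shows "submodule (torsion (S\<lparr>carrier := R\<rparr>) M I) S M"
proof -
  interpret left_module S M by fact
  interpret A: cring "S\<lparr>carrier := R\<rparr>" by fact
  let ?R = "S\<lparr>carrier := R\<rparr>"
  let ?p = "\<lambda>n::nat. I [^]\<^bsub>ideals_set ?R\<^esub> n"
  have RS: "\<And>a. a \<in> R \<Longrightarrow> a \<in> carrier S"
    using subringE(1)[OF R] by auto
  have pR: "\<And>a n. a \<in> ?p n \<Longrightarrow> a \<in> R"
    using ideal.Icarr[OF A.ideal_ideal_pow[OF I]] by simp
  show ?thesis
    unfolding submodule_iff
  proof (intro conjI ballI)
    show "torsion ?R M I \<subseteq> carrier M"
      unfolding torsion_def by auto
    show "\<zero>\<^bsub>M\<^esub> \<in> torsion ?R M I"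
      using pR[of _ 0] RS by (auto simp: torsion_def annihilator_def intro!: exI[of _ 0])
  next
    fix x y assume "x \<in> torsion ?R M I" "y \<in> torsion ?R M I"
    then obtain n m where c: "x \<in> carrier M" "y \<in> carrier M"
      and n: "?p n \<subseteq> annihilator ?R M x" and m: "?p m \<subseteq> annihilator ?R M y"
      unfolding torsion_def by auto
    \<comment> \<open>\<open>I^(n + m)\<close> lies in both \<open>I^n\<close> and
      \<open>I^m\<close>, so it kills both summands.\<close>
    have "?p (n + m) \<subseteq> annihilator ?R M (x \<oplus>\<^bsub>M\<^esub> y)"
    proof
      fix a assume a: "a \<in> ?p (n + m)"
      then have "a \<in> annihilator ?R M x" "a \<in> annihilator ?R M y"
        using A.ideal_pow_add_subset[OF I, of n m] n m by auto
      then show "a \<in> annihilator ?R M (x \<oplus>\<^bsub>M\<^esub> y)"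
        using c RS by (simp add: annihilator_def smult_r_distr)
    qed
    then show "x \<oplus>\<^bsub>M\<^esub> y \<in> torsion ?R M I"
      using c unfolding torsion_def by blast
  next
    fix s x assume s: "s \<in> carrier S" and "x \<in> torsion ?R M I"
    then obtain n where x: "x \<in> carrier M" and n: "?p n \<subseteq> annihilator ?R M x"
      unfolding torsion_def by auto
    obtain r :: nat where
      r: "(\<lambda>a. a \<otimes>\<^bsub>S\<^esub> s) ` (?p n [^]\<^bsub>ideals_set ?R\<^esub> r) \<subseteq> left_ideal_gen S (?p n)"
      using pow[OF A.ideal_ideal_pow[OF I] s] by blast
    \<comment> \<open>The annihilator is now taken in \<open>S\<close>, where it is a left ideal and
      so contains all that \<open>I^n\<close> generates.\<close>
    have "?p n \<subseteq> annihilator S M x"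
      using n RS by (auto simp: annihilator_def)
    then have "left_ideal_gen S (?p n) \<subseteq> annihilator S M x"
      using left_ideal_annihilator[OF x] unfolding left_ideal_gen_def by blast
    then have as: "a \<otimes>\<^bsub>S\<^esub> s \<in> annihilator S M x" if "a \<in> ?p (n * r)" for a
      using r that unfolding A.ideal_pow_pow[OF I] by blast
    have "a \<in> annihilator ?R M (s \<odot>\<^bsub>M\<^esub> x)" if "a \<in> ?p (n * r)" for a
      using as[OF that] pR[OF that] RS s x by (simp add: annihilator_def smult_assoc1)
    then show "s \<odot>\<^bsub>M\<^esub> x \<in> torsion ?R M I"
      using s x unfolding torsion_def by blast
  qed
qed

section \<open>The greatest associated prime of the injective hull and its descent to the
  module\<close>

theorem theorem3:
  fixes S :: "('s, 'k) ring_scheme" and R :: "'s set"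
    and M :: "('s, 'm) module" and E :: "('s, 'e) module" and \<iota> :: "'m \<Rightarrow> 'e"
  assumes "left_noetherian_ring S"
    and "subring R S"
    and "regular_ring (S\<lparr>carrier := R\<rparr>)"
    and "projective_module (S\<lparr>carrier := R\<rparr>) (right_regular_module S)"
    and "\<And>I s. ideal I (S\<lparr>carrier := R\<rparr>) \<Longrightarrow> s \<in> carrier S \<Longrightarrow>
      \<exists>r\<ge>1::nat. (\<lambda>a. a \<otimes>\<^bsub>S\<^esub> s) ` (I [^]\<^bsub>ideals_set (S\<lparr>carrier := R\<rparr>)\<^esub> r) \<subseteq> left_ideal_gen S I"
    and "left_module S M"
    and "injective_hull S M E \<iota>"
    and "indecomposable_module S E"
  shows "\<exists>P. (\<forall>Q. (Q \<in> Ass (S\<lparr>carrier := R\<rparr>) E \<and> (\<forall>Q'\<in>Ass (S\<lparr>carrier := R\<rparr>) E. Q \<subseteq> Q' \<longrightarrow> Q' = Q)) \<longleftrightarrow> Q = P) \<and>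
    P \<in> Ass (S\<lparr>carrier := R\<rparr>) M"
proof -
  let ?R = "S\<lparr>carrier := R\<rparr>"
  have inj: "injective_module S E" and \<iota>: "\<iota> \<in> module_hom S M E" "inj_on \<iota> (carrier M)"
    and ess: "\<And>N. submodule N S E \<Longrightarrow> N \<noteq> {\<zero>\<^bsub>E\<^esub>} \<Longrightarrow> N \<inter> \<iota> ` carrier M \<noteq> {\<zero>\<^bsub>E\<^esub>}"
    using assms(7) unfolding injective_hull_def by auto
  interpret M: left_module S M by fact
  interpret E: left_module S E
    using inj unfolding injective_module_def by blast
  have cR: "cring ?R" and nR: "noetherian_ring ?R"
    using assms(3) unfolding regular_ring_def by auto
  have RS: "\<And>a. a \<in> R \<Longrightarrow> a \<in> carrier S"
    using subringE(1)[OF assms(2)] by auto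
  interpret RM: noetherian_module ?R M
    using left_module_restrict[OF M.left_module_axioms assms(2)] cR nR
    by (simp add: noetherian_module_def module_iff_left_module)
  interpret RE: noetherian_module ?R E
    using left_module_restrict[OF E.left_module_axioms assms(2)] cR nR
    by (simp add: noetherian_module_def module_iff_left_module)
  have \<iota>0: "\<iota> \<zero>\<^bsub>M\<^esub> = \<zero>\<^bsub>E\<^esub>"
    using module_hom_zero[OF M.left_module_axioms E.left_module_axioms \<iota>(1)] .
  \<comment> \<open>\<open>\<iota>\<close> is injective and linear, so annihilators agree in
    \<open>M\<close> and \<open>E\<close>; this places \<open>Ass ?R M\<close> inside
    \<open>Ass ?R E\<close>.\<close>
  have \<iota>_ann: "annihilator ?R E (\<iota> m) = annihilator ?R M m" if "m \<in> carrier M" for m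
  proof -
    have "a \<odot>\<^bsub>E\<^esub> \<iota> m = \<zero>\<^bsub>E\<^esub> \<longleftrightarrow> a \<odot>\<^bsub>M\<^esub> m = \<zero>\<^bsub>M\<^esub>" if "a \<in> R" for a
      using module_homD(3)[OF \<iota>(1) RS[OF that] \<open>m \<in> carrier M\<close>] \<iota>0
        inj_onD[OF \<iota>(2), of "a \<odot>\<^bsub>M\<^esub> m" "\<zero>\<^bsub>M\<^esub>"] RS[OF that] \<open>m \<in> carrier M\<close> by auto
    then show ?thesis
      by (auto simp: annihilator_def)
  qed
  have Ass_prime: "primeideal Q ?R" if "Q \<in> Ass ?R E" for Q
    using that unfolding Ass_iff by blast
  have Ass_ME: "Q \<in> Ass ?R E" if QM: "Q \<in> Ass ?R M" for Q
  proof -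
    obtain m where m: "m \<in> carrier M" "Q = annihilator ?R M m" and Q: "primeideal Q ?R"
      using QM unfolding Ass_iff by blast
    then have "Q = annihilator ?R E (\<iota> m)"
      using \<iota>_ann by simp
    then show ?thesis
      using Q module_homD(1)[OF \<iota>(1) m(1)] unfolding Ass_iff by blast
  qed
  have tors: "submodule (torsion ?R E Q) S E" "torsion ?R E Q \<noteq> {\<zero>\<^bsub>E\<^esub>}"
    if Q: "Q \<in> Ass ?R E" for Q
  proof -
    interpret Q: primeideal Q ?R
      using Ass_prime[OF Q] .
    show "submodule (torsion ?R E Q) S E"
      by (rule submodule_torsion[OF E.left_module_axioms assms(2) cR assms(5) Q.is_ideal])
    obtain x where x: "x \<in> carrier E" "Q = annihilator ?R E x"
      using Q unfolding Ass_iff by blast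
    \<comment> \<open>The witness \<open>x\<close> of \<open>Q \<in> Ass ?R E\<close> is torsion
      with exponent 1, and it is nonzero because a prime ideal is proper.\<close>
    have "Q [^]\<^bsub>ideals_set ?R\<^esub> (1::nat) = Q"
      using comm_monoid.axioms(1)[OF cring.ideals_set_is_comm_monoid[OF cR]] Q.is_ideal
      by (subst monoid.nat_pow_eone) (auto simp: ideals_set_def)
    then have "x \<in> torsion ?R E Q"
      using x unfolding torsion_def by blast
    moreover have "x \<noteq> \<zero>\<^bsub>E\<^esub>"
    proof
      assume "x = \<zero>\<^bsub>E\<^esub>"
      then have "Q = carrier ?R"
        using x RS by (auto simp: annihilator_def)
      then show False
        using Q.I_notcarr by simp
    qed
    ultimately show "torsion ?R E Q \<noteq> {\<zero>\<^bsub>E\<^esub>}"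
      by blast
  qed
  \<comment> \<open>A power of \<open>P\<close> annihilates \<open>x\<close> and so lies in the
    prime \<open>Q\<close>, which then contains \<open>P\<close>.\<close>
  have tors_subset: "P \<subseteq> Q"
    if P: "P \<in> Ass ?R E" and Q: "primeideal Q ?R" and x: "x \<in> torsion ?R E P" "annihilator ?R E x \<subseteq> Q"
    for P Q x
  proof -
    interpret P: primeideal P ?R
      using Ass_prime[OF P] .
    show ?thesis
      using primeideal.ideal_pow_subset_imp_subset[OF Q P.is_ideal] x unfolding torsion_def by blast
  qed
  have directed: "\<exists>Q\<in>Ass ?R E. P \<subseteq> Q \<and> P' \<subseteq> Q" if P: "P \<in> Ass ?R E" "P' \<in> Ass ?R E" for P P'
  proof -
    \<comment> \<open>Uniformity of \<open>E\<close> concerns \<open>S\<close>-submodules, which is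
      why the torsion sets had to be closed under scalars from \<open>S\<close> and not just from
      \<open>R\<close>.\<close>
    have "torsion ?R E P \<inter> torsion ?R E P' \<noteq> {\<zero>\<^bsub>E\<^esub>}"
      using indecomposable_injective_uniform[OF inj assms(8) tors(1)[OF P(1)] tors(1)[OF P(2)]]
        tors(2)[OF P(1)] tors(2)[OF P(2)] by blast
    then obtain x where x: "x \<in> torsion ?R E P" "x \<in> torsion ?R E P'" "x \<noteq> \<zero>\<^bsub>E\<^esub>"
      using E.submoduleD(2)[OF tors(1)[OF P(1)]] E.submoduleD(2)[OF tors(1)[OF P(2)]] by blast
    then have "x \<in> carrier E"
      unfolding torsion_def by blast
    then obtain Q where "Q \<in> Ass ?R E" "annihilator ?R E x \<subseteq> Q"
      using RE.exists_associated_prime[OF _ x(3)] by blast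
    then show ?thesis
      using tors_subset[OF P(1) Ass_prime x(1)] tors_subset[OF P(2) Ass_prime x(2)] by blast
  qed
  obtain e where "e \<in> carrier E" "e \<noteq> \<zero>\<^bsub>E\<^esub>"
    using assms(8) E.zero_closed unfolding indecomposable_module_def by blast
  then have "Ass ?R E \<noteq> {}"
    using RE.exists_associated_prime by blast
  then obtain P where P: "P \<in> Ass ?R E" and P_max: "\<And>Q. Q \<in> Ass ?R E \<Longrightarrow> P \<subseteq> Q \<Longrightarrow> Q = P"
    using noetherian_ring.maximal_ideal_in_family[OF nR, of "Ass ?R E"] primeideal.axioms(1) Ass_prime by metis
  \<comment> \<open>In a directed set a maximal element is the greatest one.\<close>
  have greatest: "Q \<subseteq> P" if "Q \<in> Ass ?R E" for Q
    using directed[OF P that] P_max by blast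
  have "torsion ?R E P \<inter> \<iota> ` carrier M \<noteq> {\<zero>\<^bsub>E\<^esub>}"
    using ess[OF tors(1)[OF P] tors(2)[OF P]] .
  \<comment> \<open>Essentiality only says that the intersection differs from the zero submodule.
    Zero being a member excludes the empty set, so a nonzero element exists.\<close>
  moreover have "\<zero>\<^bsub>E\<^esub> \<in> torsion ?R E P \<inter> \<iota> ` carrier M"
    using E.submoduleD(2)[OF tors(1)[OF P]] \<iota>0 M.zero_closed by (metis IntI imageI)
  ultimately obtain m where m: "m \<in> carrier M" "\<iota> m \<in> torsion ?R E P" "\<iota> m \<noteq> \<zero>\<^bsub>E\<^esub>"
    by blast
  then obtain Q where Q: "Q \<in> Ass ?R M" "annihilator ?R M m \<subseteq> Q"
    using RM.exists_associated_prime[of m] \<iota>0 by metis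
  \<comment> \<open>\<open>m\<close> and \<open>\<iota> m\<close> have the same annihilator, so
    \<open>Q\<close> contains a power of \<open>P\<close>. As \<open>Q\<close> is also associated to
    \<open>E\<close>, maximality of \<open>P\<close> then gives \<open>Q = P\<close>.\<close>
  have "P \<subseteq> Q"
    using tors_subset[OF P Ass_prime[OF Ass_ME[OF Q(1)]] m(2)] Q(2) \<iota>_ann[OF m(1)] by simp
  then have "P \<in> Ass ?R M"
    using P_max[OF Ass_ME[OF Q(1)]] Q(1) by simp
  \<comment> \<open>Any maximal \<open>Q\<close> lies below the greatest element \<open>P\<close>,
    hence equals it.\<close>
  moreover have "(Q \<in> Ass ?R E \<and> (\<forall>Q'\<in>Ass ?R E. Q \<subseteq> Q' \<longrightarrow> Q' = Q)) \<longleftrightarrow> Q = P" for Q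
    using P P_max greatest by blast
  ultimately show ?thesis
    by blast
qed

end
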